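(* Let $\alpha\in\mathbb N_0^4$, $\beta\in\mathbb N_0^{\mathcal E_4}$, and let $e,e^\ast\in\mathcal E_4$ be opposite edges, i.e. $e=ab$ and $e^\ast=cd$ with $\{a,b,c,d\}=\{0,1,2,3\}$. If $\beta_e\ge1$ and $\beta_{e^\ast}\ge1$, then $$\mathcal M_\beta^\alpha=\mathcal M_{\beta-\mathbf e_e}^\alpha+\mathcal M_{\beta-\mathbf e_{e^\ast}}^\alpha.$$ If $\mathcal M_\beta^\alpha$ is finite, then $\mathcal M_{\beta-\mathbf e_e}^\alpha$ and $\mathcal M_{\beta-\mathbf e_{e^\ast}}^\alpha$ are finite as well.
   Context: Let $T\subset\mathbb R^3$ be a tetrahedron with barycentric coordinates $\lambda_0,\dots,\lambda_3$, and let $\mathcal E_4=\{ij:0\le i<j\le3\}$ be the set of unordered pairs (edges). For $\alpha\in\mathbb N_0^4$, $\beta\in\mathbb N_0^{\mathcal E_4}$ set $$R_\beta^\alpha(\lambda)=\frac{\prod_{i=0}^3\lambda_i^{\alpha_i}}{\prod_{ij\in\mathcal E_4}(\lambda_i+\lambda_j)^{\beta_{ij}}},\qquad \mathcal M_\beta^\alpha=|T|^{-1}\int_TR_\beta^\alpha(\lambda(x))\,\mathrm dx\in[0,\infty],$$ which is independent of $T$. For $e\in\mathcal E_4$, $\mathbf e_e\in\mathbb N_0^{\mathcal E_4}$ is the unit multi-index with entry one at $e$ and zero elsewhere. *)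

theory Defs
  imports "HOL-Analysis.Analysis"
begin

text \<open>
  The vertices of a tetrahedron are indexed by the four-element type \<^typ>\<open>4\<close>, whose elements
  are the residues 0, 1, 2, 3.
\<close>

definition nondegenerate :: "(4 \<Rightarrow> real ^ 3) \<Rightarrow> bool" where
  "nondegenerate v \<longleftrightarrow> inj v \<and> \<not> affine_dependent (range v)"

definition tetrahedron :: "(4 \<Rightarrow> real ^ 3) \<Rightarrow> (real ^ 3) set" where
  "tetrahedron v = convex hull (range v)"

text \<open>
  The description below determines the coordinates uniquely, for every point of space, when \<open>v\<close> is
  nondegenerate.
\<close>

definition barycentric :: "(4 \<Rightarrow> real ^ 3) \<Rightarrow> real ^ 3 \<Rightarrow> 4 \<Rightarrow> real" where
  "barycentric v x = (THE l. (\<Sum>i\<in>UNIV. l i) = 1 \<and> (\<Sum>i\<in>UNIV. l i *\<^sub>R v i) = x)"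

definition edges :: "4 set set" where
  "edges = {{i, j} | i j. i \<noteq> j}"

text \<open>
  A multi-index over the edges is a function on all sets of vertices, of which only the values on
  \<^const>\<open>edges\<close> are ever used. Subtraction of multi-indices is the pointwise (truncated)
  subtraction of functions.
\<close>

definition unit_index :: "4 set \<Rightarrow> 4 set \<Rightarrow> nat" where
  "unit_index e = (\<lambda>f. if f = e then 1 else 0)"

text \<open>
  For an edge \<open>f = {i, j}\<close> the inner sum is \<open>l i + l j\<close>. Where a denominator with positive exponent
  vanishes, the quotient is 0 by the convention for real division; on a tetrahedron this happens
  only on edges, hence on a null set, and does not affect the integral below.
\<close>

definition R :: "(4 \<Rightarrow> nat) \<Rightarrow> (4 set \<Rightarrow> nat) \<Rightarrow> (4 \<Rightarrow> real) \<Rightarrow> real" where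
  "R \<alpha> \<beta> l = (\<Prod>i\<in>UNIV. l i ^ \<alpha> i) / (\<Prod>f\<in>edges. (\<Sum>i\<in>f. l i) ^ \<beta> f)"

definition M :: "(4 \<Rightarrow> real ^ 3) \<Rightarrow> (4 \<Rightarrow> nat) \<Rightarrow> (4 set \<Rightarrow> nat) \<Rightarrow> ennreal" where
  "M v \<alpha> \<beta> = inverse (emeasure lborel (tetrahedron v)) *
     (\<integral>\<^sup>+x\<in>tetrahedron v. ennreal (R \<alpha> \<beta> (barycentric v x)) \<partial>lborel)"

end

theory Submission
  imports Defs
begin

text \<open>
  Let \<open>x = \<lambda>\<^sub>a + \<lambda>\<^sub>b\<close> and \<open>y = \<lambda>\<^sub>c + \<lambda>\<^sub>d\<close> be the linear factors of the denominator that belong to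
  the two opposite edges. Each vertex lies on exactly one of the two edges, so \<open>x + y = 1\<close> on the
  tetrahedron, and \<open>1 / (x * y) = (x + y) / (x * y) = 1 / y + 1 / x\<close>. Hence the identity holds for
  the integrands, as long as no factor vanishes (\<open>R_partial_fractions\<close>), and it remains to
  integrate it.

  Integration needs two facts. The identity may fail where \<open>x\<close> or \<open>y\<close> is zero, but all coordinates
  are positive off the four faces, which are null sets (\<open>AE_barycentric_pos\<close>). The integral of a sum
  of nonnegative functions is the sum of the integrals only for measurable functions; here the
  coordinates are even continuous on the tetrahedron (\<open>continuous_on_barycentric\<close>). The resulting
  identity holds in \<open>[0, \<infinity>]\<close>, where a finite sum has finite summands.
\<close>

lemma barycentric_coordinates_unique:
  assumes v: "nondegenerate v"
    and s: "(\<Sum>i\<in>UNIV. l i) = (\<Sum>i\<in>UNIV. m i)"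
    and c: "(\<Sum>i\<in>UNIV. l i *\<^sub>R v i) = (\<Sum>i\<in>UNIV. m i *\<^sub>R v i)"
  shows "l = m"
proof (rule ccontr)
  assume "l \<noteq> m"
  then obtain k where k: "l k \<noteq> m k" by blast
  have inj: "inj v" using v by (simp add: nondegenerate_def)
  \<comment> \<open>The differences of the coefficients, carried over to the vertices, form an affine dependence.\<close>
  define U where "U p = l (inv v p) - m (inv v p)" for p
  have Uv: "U (v i) = l i - m i" for i
    using inj by (simp add: U_def)
  have "sum U (range v) = 0"
    using s by (simp add: sum.reindex[OF inj] Uv sum_subtractf)
  moreover have "(\<Sum>p\<in>range v. U p *\<^sub>R p) = 0"
    using c by (simp add: sum.reindex[OF inj] Uv sum_subtractf scaleR_left_diff_distrib)
  moreover have "\<exists>p\<in>range v. U p \<noteq> 0"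
    using k Uv by auto
  ultimately have "affine_dependent (range v)"
    by (subst affine_dependent_explicit_finite) auto
  then show False using v by (simp add: nondegenerate_def)
qed

lemma barycentric_affine_combination:
  assumes "nondegenerate v" and "(\<Sum>i\<in>UNIV. l i) = 1"
  shows "barycentric v (\<Sum>i\<in>UNIV. l i *\<^sub>R v i) = l"
  unfolding barycentric_def
  by (rule the_equality) (use assms in \<open>auto intro!: barycentric_coordinates_unique[OF assms(1)]\<close>)

lemma tetrahedron_barycentric:
  assumes v: "nondegenerate v" and x: "x \<in> tetrahedron v"
  shows "barycentric v x i \<ge> 0"
    and "(\<Sum>i\<in>UNIV. barycentric v x i) = 1"
    and "(\<Sum>i\<in>UNIV. barycentric v x i *\<^sub>R v i) = x"
proof -
  have inj: "inj v" using v by (simp add: nondegenerate_def)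
  obtain u where u: "\<forall>p\<in>range v. 0 \<le> u p" "sum u (range v) = 1"
    "(\<Sum>p\<in>range v. u p *\<^sub>R p) = x"
    using x unfolding tetrahedron_def by (subst (asm) convex_hull_finite) auto
  have s: "(\<Sum>i\<in>UNIV. u (v i)) = 1" and c: "(\<Sum>i\<in>UNIV. u (v i) *\<^sub>R v i) = x"
    using u by (simp_all add: sum.reindex[OF inj])
  have b: "barycentric v x = (\<lambda>i. u (v i))"
    using barycentric_affine_combination[OF v s] c by simp
  show "barycentric v x i \<ge> 0" "(\<Sum>i\<in>UNIV. barycentric v x i) = 1"
    "(\<Sum>i\<in>UNIV. barycentric v x i *\<^sub>R v i) = x"
    using u s c by (simp_all add: b)
qed

text \<open>
  The coordinates of \<open>x\<close> are the preimage of \<open>(x, 1)\<close> under the linear map that sends \<open>l\<close> to its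
  weighted sum of vertices, paired with its total weight. This map is injective, and a linear left
  inverse is continuous since the spaces are finite dimensional.
\<close>
lemma continuous_on_barycentric:
  assumes v: "nondegenerate v"
  shows "continuous_on (tetrahedron v) (\<lambda>x. barycentric v x i)"
proof -
  define f :: "real ^ 4 \<Rightarrow> (real ^ 3) \<times> real"
    where "f l = (\<Sum>i\<in>UNIV. (l $ i) *\<^sub>R v i, \<Sum>i\<in>UNIV. l $ i)" for l
  have "linear f"
    by (rule linearI)
      (simp_all add: f_def scaleR_add_left sum.distrib scaleR_sum_right sum_distrib_left)
  moreover have "inj f"
  proof (rule injI)
    fix l m assume "f l = f m"
    then have "($) l = ($) m"
      by (intro barycentric_coordinates_unique[OF v]) (simp_all add: f_def)
    then show "l = m" by (simp add: vec_eq_iff)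
  qed
  ultimately obtain g where g: "linear g" "g \<circ> f = id"
    using linear_injective_left_inverse by blast
  have "barycentric v x i = g (x, 1) $ i" if "x \<in> tetrahedron v" for x
  proof -
    have "f (\<chi> i. barycentric v x i) = (x, 1)"
      using tetrahedron_barycentric[OF v that] by (simp add: f_def)
    then have "g (x, 1) = (\<chi> i. barycentric v x i)"
      using g(2) by (metis comp_apply id_apply)
    then show ?thesis by simp
  qed
  moreover have "continuous_on (tetrahedron v) (\<lambda>x. g (x, 1) $ i)"
    by (intro continuous_on_component linear_continuous_on_compose[OF _ g(1)] continuous_intros)
  ultimately show ?thesis
    using continuous_on_cong by force
qed

lemma tetrahedron_in_borel: "tetrahedron v \<in> sets borel"
  by (simp add: tetrahedron_def borel_closed compact_imp_closed compact_convex_hull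
      finite_imp_compact)

text \<open>
  A point whose coordinate \<open>i\<close> vanishes lies in the convex hull of the other three vertices, and a
  convex set with empty interior is a null set.
\<close>
lemma AE_barycentric_pos:
  assumes v: "nondegenerate v"
  shows "AE x in lborel. x \<in> tetrahedron v \<longrightarrow> (\<forall>i. barycentric v x i > 0)"
proof -
  define F where "F i = convex hull (v ` (UNIV - {i}))" for i
  have F: "AE x in lborel. x \<notin> F i" for i
  proof -
    have closed: "closed (F i)"
      unfolding F_def by (simp add: compact_imp_closed compact_convex_hull finite_imp_compact)
    have "card (v ` (UNIV - {i})) \<le> DIM(real ^ 3)"
      using card_image_le[of "UNIV - {i}" v] by simp
    then have "interior (F i) = {}"
      unfolding F_def by (intro empty_interior_convex_hull) auto
    then have "frontier (F i) = F i"
      using closed by (simp add: frontier_def)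
    then have "negligible (F i)"
      using negligible_convex_frontier[of "F i"] by (simp add: F_def)
    then have "F i \<in> null_sets lborel"
      using closed by (simp add: negligible_iff_null_sets null_sets_completion_iff borel_closed)
    then show ?thesis by (rule AE_not_in)
  qed
  have zero: "x \<in> F i" if x: "x \<in> tetrahedron v" and i: "barycentric v x i = 0" for x i
  proof -
    note b = tetrahedron_barycentric[OF v x]
    have "(\<Sum>j\<in>UNIV - {i}. barycentric v x j) = 1"
      using b(2) i by (simp add: sum.remove[of UNIV i])
    moreover have "(\<Sum>j\<in>UNIV - {i}. barycentric v x j *\<^sub>R v j) = x"
      using b(3) i by (simp add: sum.remove[of UNIV i])
    moreover have "(\<Sum>j\<in>UNIV - {i}. barycentric v x j *\<^sub>R v j) \<in> F i"
      if "(\<Sum>j\<in>UNIV - {i}. barycentric v x j) = 1"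
      unfolding F_def
      by (rule convex_sum) (use that b(1) in \<open>auto intro: hull_inc\<close>)
    ultimately show ?thesis by simp
  qed
  have "AE x in lborel. \<forall>i. x \<notin> F i"
    using F by (subst AE_all_countable) auto
  then show ?thesis
    by eventually_elim (use zero tetrahedron_barycentric(1)[OF v] in \<open>metis less_eq_real_def\<close>)
qed

lemma R_nonneg:
  assumes "\<And>i. l i \<ge> 0"
  shows "R \<alpha> \<beta> l \<ge> 0"
  unfolding R_def by (intro divide_nonneg_nonneg prod_nonneg sum_nonneg zero_le_power ballI assms)

text \<open>
  The vanishing of the factor has to be excluded for \<open>\<beta> f = 1\<close>: the factor then disappears on the
  left, whereas the right-hand side is zero.
\<close>
lemma R_diff_unit_index:
  assumes f: "f \<in> edges" and pos: "\<beta> f \<ge> 1" and nz: "(\<Sum>i\<in>f. l i) \<noteq> 0"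
  shows "R \<alpha> (\<beta> - unit_index f) l = (\<Sum>i\<in>f. l i) * R \<alpha> \<beta> l"
proof -
  define D where "D = (\<Prod>h\<in>edges - {f}. (\<Sum>i\<in>h. l i) ^ \<beta> h)"
  have "(\<Prod>h\<in>edges. (\<Sum>i\<in>h. l i) ^ (\<beta> - unit_index f) h) = (\<Sum>i\<in>f. l i) ^ (\<beta> f - 1) * D"
    unfolding D_def by (subst prod.remove[OF _ f]) (auto simp: unit_index_def intro!: prod.cong)
  moreover have "(\<Prod>h\<in>edges. (\<Sum>i\<in>h. l i) ^ \<beta> h) =
      (\<Sum>i\<in>f. l i) * ((\<Sum>i\<in>f. l i) ^ (\<beta> f - 1) * D)"
    unfolding D_def by (subst prod.remove[OF _ f]) (use pos in \<open>simp_all add: power_eq_if\<close>)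
  ultimately show ?thesis
    using nz by (simp add: R_def)
qed

lemma R_partial_fractions:
  assumes e: "e \<in> edges" "\<beta> e \<ge> 1" "(\<Sum>i\<in>e. l i) \<noteq> 0"
    and e': "e' \<in> edges" "\<beta> e' \<ge> 1" "(\<Sum>i\<in>e'. l i) \<noteq> 0"
    and opposite: "e \<inter> e' = {}" "e \<union> e' = UNIV"
    and one: "(\<Sum>i\<in>UNIV. l i) = 1"
  shows "R \<alpha> \<beta> l = R \<alpha> (\<beta> - unit_index e) l + R \<alpha> (\<beta> - unit_index e') l"
proof -
  have "(\<Sum>i\<in>e. l i) + (\<Sum>i\<in>e'. l i) = 1"
    using sum.union_disjoint[of e e' l] opposite one by simp
  then show ?thesis
    by (simp add: R_diff_unit_index[where \<beta> = \<beta>, OF e]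
        R_diff_unit_index[where \<beta> = \<beta>, OF e'] flip: distrib_right)
qed

lemma R_barycentric_measurable:
  assumes "nondegenerate v"
  shows "(\<lambda>x. ennreal (R \<alpha> \<beta> (barycentric v x)))
    \<in> borel_measurable (restrict_space lborel (tetrahedron v))"
proof -
  have [measurable]: "(\<lambda>x. barycentric v x i)
      \<in> borel_measurable (restrict_space lborel (tetrahedron v))" for i
    using borel_measurable_continuous_on_restrict[OF continuous_on_barycentric[OF assms]]
    by (simp add: measurable_def space_restrict_space sets_restrict_space)
  show ?thesis unfolding R_def by measurable
qed

lemma M_restrict_space:
  "M v \<alpha> \<beta> = inverse (emeasure lborel (tetrahedron v)) *
     (\<integral>\<^sup>+x. ennreal (R \<alpha> \<beta> (barycentric v x)) \<partial>restrict_space lborel (tetrahedron v))"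
  unfolding M_def by (subst nn_integral_restrict_space) (simp_all add: tetrahedron_in_borel)

lemma opposite_edges_disjoint:
  fixes a b c d :: 4
  assumes "{a, b, c, d} = UNIV"
  shows "{a, b} \<inter> {c, d} = {}"
proof -
  \<comment> \<open>A common vertex would leave at most three of the four vertices.\<close>
  have "{a, b} \<union> {c, d} = UNIV"
    using assms by auto
  then have "card ({a, b} \<union> {c, d}) = 4"
    by (simp del: Un_insert_left Un_insert_right)
  moreover have "card {a, b} \<le> 2" "card {c, d} \<le> 2"
    by (simp_all add: card_insert_if)
  ultimately have "card ({a, b} \<inter> {c, d}) = 0"
    using card_Un_Int[OF finite finite, of "{a, b}" "{c, d}"] by linarith
  then show ?thesis by simp
qed

theorem lemma4p1:
  fixes v :: "4 \<Rightarrow> real ^ 3"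
    and \<alpha> :: "4 \<Rightarrow> nat"
    and \<beta> :: "4 set \<Rightarrow> nat"
    and e e' :: "4 set"
    and a b c d :: 4
  assumes "nondegenerate v"
    and "e \<in> edges" and "e' \<in> edges"
    and "e = {a, b}" and "e' = {c, d}" and "{a, b, c, d} = UNIV"
    and "\<beta> e \<ge> 1" and "\<beta> e' \<ge> 1"
  shows "M v \<alpha> \<beta> = M v \<alpha> (\<beta> - unit_index e) + M v \<alpha> (\<beta> - unit_index e') \<and>
         (M v \<alpha> \<beta> < \<infinity> \<longrightarrow>
           M v \<alpha> (\<beta> - unit_index e) < \<infinity> \<and> M v \<alpha> (\<beta> - unit_index e') < \<infinity>)"
proof -
  let ?N = "restrict_space lborel (tetrahedron v)"
  let ?r = "\<lambda>\<gamma> x. ennreal (R \<alpha> \<gamma> (barycentric v x))"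
  note v = assms(1)
  have opposite: "e \<inter> e' = {}" "e \<union> e' = UNIV"
    using opposite_edges_disjoint[of a b c d] assms(4-6) by auto
  have "AE x in ?N. \<forall>i. barycentric v x i > 0"
    using AE_barycentric_pos[OF v] by (simp add: AE_restrict_space_iff tetrahedron_in_borel)
  then have "AE x in ?N. ?r \<beta> x = ?r (\<beta> - unit_index e) x + ?r (\<beta> - unit_index e') x"
  proof (rule AE_mp, intro AE_I2 impI)
    fix x assume "x \<in> space ?N" and pos: "\<forall>i. barycentric v x i > 0"
    then have x: "x \<in> tetrahedron v" by (simp add: space_restrict_space)
    have "(\<Sum>i\<in>e. barycentric v x i) > 0" "(\<Sum>i\<in>e'. barycentric v x i) > 0"
      using pos assms(4,5) by (auto intro!: sum_pos)
    then have "R \<alpha> \<beta> (barycentric v x) =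
        R \<alpha> (\<beta> - unit_index e) (barycentric v x) + R \<alpha> (\<beta> - unit_index e') (barycentric v x)"
      using assms(2,3,7,8) opposite tetrahedron_barycentric(2)[OF v x]
      by (intro R_partial_fractions) auto
    then show "?r \<beta> x = ?r (\<beta> - unit_index e) x + ?r (\<beta> - unit_index e') x"
      using tetrahedron_barycentric(1)[OF v x] by (simp add: R_nonneg)
  qed
  then have "(\<integral>\<^sup>+x. ?r \<beta> x \<partial>?N) =
      (\<integral>\<^sup>+x. ?r (\<beta> - unit_index e) x + ?r (\<beta> - unit_index e') x \<partial>?N)"
    by (rule nn_integral_cong_AE)
  also have "\<dots> = (\<integral>\<^sup>+x. ?r (\<beta> - unit_index e) x \<partial>?N) + (\<integral>\<^sup>+x. ?r (\<beta> - unit_index e') x \<partial>?N)"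
    by (intro nn_integral_add R_barycentric_measurable v)
  finally have "M v \<alpha> \<beta> = M v \<alpha> (\<beta> - unit_index e) + M v \<alpha> (\<beta> - unit_index e')"
    by (simp add: M_restrict_space distrib_left)
  then show ?thesis by simp
qed

end
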